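(* Assume that the Newton polytope $\mathrm{New}(Z)$ of the polynomial $Z(\beta;p)$ in $p$ has dimension $n-d$. Then: 1. The image of the moment map $E[U]:\mathbb{R}^n\to\mathbb{R}^n$, $\xi\mapsto E[U](\xi)$, is equal to the relative interior of $\mathrm{New}(Z)$. 2. The map $$E[U]:\ \mathbb{R}^n/\mathrm{Im}\,A^T\longrightarrow \mathrm{relint}(\mathrm{New}(Z))$$ induced by the moment map (which is constant on cosets of $\mathrm{Im}\,A^T$) is one-to-one.
   Context: $\mathbb{N}$ denotes the non-negative integers. $A$ is a $d\times n$ matrix with non-negative integer entries and rank $d$, which is a configuration matrix, i.e. $(1,\ldots,1)^T\in\mathbb{R}^n$ lies in the image of $A^T:\mathbb{R}^d\to\mathbb{R}^n$. Let $a_i$ be the $i$-th column of $A$ and $\mathbb{N}A=\sum_{i=1}^n\mathbb{N}a_i$. Fix $\beta\in\mathbb{N}A$, $\beta\neq 0$. The $A$-hypergeometric polynomial is $$Z(\beta;p)=\sum_{u\in\mathbb{N}^n,\ Au=\beta}\frac{p^u}{u!},\qquad p^u=\prod_{i=1}^n p_i^{u_i},\quad u!=\prod_{i=1}^n u_i!.$$ For $\xi\in\mathbb{R}^n$ put $p(\xi)=(\exp\xi_1,\ldots,\exp\xi_n)$. The $A$-hypergeometric distribution with parameter $\xi$ is the probability distribution on $\{u\in\mathbb{N}^n: Au=\beta\}$ with $P(U=u)=\dfrac{p(\xi)^u}{u!\,Z(\beta;p(\xi))}$. The moment map is $E[U](\xi)=(E[U_1],\ldots,E[U_n])$, where $$E[U_i]=\sum_{u\in\mathbb{N}^n,\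 Au=\beta}u_i\frac{p(\xi)^u}{u!\,Z(\beta;p(\xi))}.$$ The Newton polytope $\mathrm{New}(Z)\subset\mathbb{R}^n$ is the convex hull of the exponents of $Z$, i.e. of $\{u\in\mathbb{N}^n: Au=\beta\}$; "relint" denotes the relative interior. *)

theory Defs
  imports "HOL-Analysis.Analysis"
begin

definition real_vec :: "nat ^ 'n \<Rightarrow> real ^ 'n" where
  "real_vec u = (\<chi> i. real (u $ i))"

definition real_mat :: "nat ^ 'n ^ 'd \<Rightarrow> real ^ 'n ^ 'd" where
  "real_mat A = (\<chi> i j. real (A $ i $ j))"

definition image_transpose :: "nat ^ 'n ^ 'd \<Rightarrow> (real ^ 'n) set" where
  "image_transpose A = range (\<lambda>y. transpose (real_mat A) *v y)"

definition configuration_matrix :: "nat ^ 'n ^ 'd \<Rightarrow> bool" where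
  "configuration_matrix A \<longleftrightarrow> (\<chi> i. 1) \<in> image_transpose A"

definition column_monoid :: "nat ^ 'n ^ 'd \<Rightarrow> (nat ^ 'd) set" where
  "column_monoid A = {\<Sum>i\<in>UNIV. c i *s column i A |c. True}"

text \<open>The fiber is finite whenever \<open>A\<close> is a configuration matrix, so the sums over it below
  are genuine finite sums; for other matrices they may take the default value \<open>0\<close>.\<close>

definition fiber :: "nat ^ 'n ^ 'd \<Rightarrow> nat ^ 'd \<Rightarrow> (nat ^ 'n) set" where
  "fiber A \<beta> = {u. A *v u = \<beta>}"

definition monomial_at :: "real ^ 'n \<Rightarrow> nat ^ 'n \<Rightarrow> real" where
  "monomial_at p u = (\<Prod>i\<in>UNIV. (p $ i) ^ (u $ i))"

definition multi_fact :: "nat ^ 'n \<Rightarrow> real" where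
  "multi_fact u = (\<Prod>i\<in>UNIV. fact (u $ i))"

definition hypergeometric_poly :: "nat ^ 'n ^ 'd \<Rightarrow> nat ^ 'd \<Rightarrow> real ^ 'n \<Rightarrow> real" where
  "hypergeometric_poly A \<beta> p = (\<Sum>u\<in>fiber A \<beta>. monomial_at p u / multi_fact u)"

text \<open>Every monomial indexed by the fiber has the nonzero coefficient \<open>1 / u!\<close>, so the fiber is
  exactly the set of exponents of the hypergeometric polynomial.\<close>

definition newton_polytope :: "nat ^ 'n ^ 'd \<Rightarrow> nat ^ 'd \<Rightarrow> (real ^ 'n) set" where
  "newton_polytope A \<beta> = convex hull (real_vec ` fiber A \<beta>)"

definition exp_vec :: "real ^ 'n \<Rightarrow> real ^ 'n" where
  "exp_vec \<xi> = (\<chi> i. exp (\<xi> $ i))"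

definition hypergeometric_prob ::
    "nat ^ 'n ^ 'd \<Rightarrow> nat ^ 'd \<Rightarrow> real ^ 'n \<Rightarrow> nat ^ 'n \<Rightarrow> real" where
  "hypergeometric_prob A \<beta> \<xi> u =
     monomial_at (exp_vec \<xi>) u / (multi_fact u * hypergeometric_poly A \<beta> (exp_vec \<xi>))"

definition moment_map :: "nat ^ 'n ^ 'd \<Rightarrow> nat ^ 'd \<Rightarrow> real ^ 'n \<Rightarrow> real ^ 'n" where
  "moment_map A \<beta> \<xi> =
     (\<chi> i. \<Sum>u\<in>fiber A \<beta>. real (u $ i) * hypergeometric_prob A \<beta> \<xi> u)"

definition coset_rel :: "nat ^ 'n ^ 'd \<Rightarrow> ((real ^ 'n) \<times> (real ^ 'n)) set" where
  "coset_rel A = {(\<xi>, \<eta>). \<xi> - \<eta> \<in> image_transpose A}"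

text \<open>The map on equivalence classes induced by \<open>f\<close>; meaningful when \<open>f\<close> is constant on each
  class, so that the image of a class is a singleton.\<close>

definition induced_map :: "('a \<Rightarrow> 'b) \<Rightarrow> 'a set \<Rightarrow> 'b" where
  "induced_map f C = the_elem (f ` C)"

end

theory Submission
  imports Defs
begin

text \<open>The \<open>A\<close>-hypergeometric distribution is a finite exponential family: since
  \<open>p(\<xi>)\<^sup>u = exp (u \<bullet> \<xi>)\<close>, the point \<open>u\<close> of the fibre has weight \<open>1 / u!\<close>
  and is tilted by \<open>exp (u \<bullet> \<xi>)\<close>. Everything about its mean that is independent of \<open>A\<close> holds
  for an arbitrary finite family of points \<open>v i\<close> with positive weights \<open>w i\<close>.

  The mean is a convex combination of all points with positive coefficients, hence in the relative
  interior of their hull (\<open>positive_combination_in_rel_interior\<close>). Conversely, let \<open>z\<close> be in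
  this relative interior. In every direction \<open>x\<close> of the affine hull some point lies strictly
  beyond \<open>z\<close>, by a margin proportional to \<open>norm x\<close> (\<open>rel_interior_coercive\<close>). So
  the sum of \<open>w i * exp ((v i - z) \<bullet> x)\<close> is coercive on the direction space of the affine
  hull, where it has a minimum; its gradient vanishes there, which says that the mean is \<open>z\<close>
  (\<open>rel_interior_is_mean\<close>).

  Two parameters have the same mean exactly if their difference is orthogonal to all differences
  \<open>v i - v j\<close> (\<open>mean_eq_iff\<close>), because \<open>exp\<close> is strictly increasing. For a fibre
  of \<open>A\<close> these differences lie in the kernel of \<open>A\<close>, so the orthogonality holds on the
  image of the transpose; when the Newton polytope has the dimension \<open>n - d\<close> of that kernel, it
  holds only there (\<open>orthogonal_fiber_in_image_transpose\<close>). Hence the fibres of the moment map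
  are the cosets of this image.\<close>

section \<open>The relative interior of a polytope\<close>

text \<open>The coefficients are indexed by \<open>I\<close> instead of by the points, so that they can be compared
  with those of another combination even where \<open>v\<close> repeats a point.\<close>

lemma in_convex_hull_imageD:
  fixes v :: "'i \<Rightarrow> 'a :: real_vector"
  assumes finite_index: "finite I"
    and x: "x \<in> convex hull (v ` I)"
  obtains b where "\<And>i. i \<in> I \<Longrightarrow> 0 \<le> b i" "sum b I = 1" "x = (\<Sum>i\<in>I. b i *\<^sub>R v i)"
proof -
  let ?T = "{x. \<exists>b. (\<forall>i\<in>I. 0 \<le> b i) \<and> sum b I = 1 \<and> x = (\<Sum>i\<in>I. b i *\<^sub>R v i)}"
  have "v ` I \<subseteq> ?T"
  proof clarify
    fix k assume "k \<in> I"
    have "(\<Sum>i\<in>I. (if i = k then 1 else 0) *\<^sub>R v i) = (\<Sum>i\<in>I. if i = k then v i else 0)"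
      by (intro sum.cong) auto
    also have "\<dots> = v k" using \<open>k \<in> I\<close> finite_index by simp
    finally show "\<exists>b. (\<forall>i\<in>I. 0 \<le> b i) \<and> sum b I = 1 \<and> v k = (\<Sum>i\<in>I. b i *\<^sub>R v i)"
      using \<open>k \<in> I\<close> finite_index by (intro exI[of _ "\<lambda>i. if i = k then 1 else 0"]) simp
  qed
  moreover have "convex ?T"
  proof (rule convexI, clarify)
    fix s t :: real and b c :: "'i \<Rightarrow> real"
    assume "0 \<le> s" "0 \<le> t" "s + t = 1" "\<forall>i\<in>I. 0 \<le> b i" "sum b I = 1" "\<forall>i\<in>I. 0 \<le> c i" "sum c I = 1"
    then show "\<exists>d. (\<forall>i\<in>I. 0 \<le> d i) \<and> sum d I = 1 \<and>
        s *\<^sub>R (\<Sum>i\<in>I. b i *\<^sub>R v i) + t *\<^sub>R (\<Sum>i\<in>I. c i *\<^sub>R v i) = (\<Sum>i\<in>I. d i *\<^sub>R v i)"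
      by (intro exI[of _ "\<lambda>i. s * b i + t * c i"])
        (simp add: sum.distrib scaleR_add_left scaleR_sum_right sum_distrib_left[symmetric])
  qed
  ultimately have "convex hull (v ` I) \<subseteq> ?T" by (rule hull_minimal)
  then show ?thesis using x that by blast
qed

text \<open>From any point \<open>x\<close> of the hull, the segment to the combination can be prolonged a little
  beyond its end: this changes the coefficients only slightly, so they stay nonnegative.\<close>

lemma positive_combination_in_rel_interior:
  fixes v :: "'i \<Rightarrow> 'a :: euclidean_space"
  assumes finite_index: "finite I"
    and pos: "\<And>i. i \<in> I \<Longrightarrow> 0 < c i"
    and sum1: "sum c I = 1"
  shows "(\<Sum>i\<in>I. c i *\<^sub>R v i) \<in> rel_interior (convex hull (v ` I))"
proof -
  let ?S = "convex hull (v ` I)"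
  let ?z = "\<Sum>i\<in>I. c i *\<^sub>R v i"
  have index_nonempty: "I \<noteq> {}" using sum1 by auto
  then have ne: "?S \<noteq> {}" by simp
  define \<delta> where "\<delta> = Min (c ` I)"
  have \<delta>: "0 < \<delta>" "\<And>i. i \<in> I \<Longrightarrow> \<delta> \<le> c i"
    using pos finite_index index_nonempty by (auto simp: \<delta>_def)
  have "\<exists>e>1. (1 - e) *\<^sub>R x + e *\<^sub>R ?z \<in> ?S" if xS: "x \<in> ?S" for x
  proof -
    obtain b where b: "\<And>i. i \<in> I \<Longrightarrow> 0 \<le> b i" "sum b I = 1" "x = (\<Sum>i\<in>I. b i *\<^sub>R v i)"
      using in_convex_hull_imageD[OF finite_index xS] by blast
    \<comment> \<open>The factor \<open>1 + \<delta>\<close> works because \<open>\<delta> * b i \<le> \<delta> \<le> c i\<close>.\<close>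
    have "(\<Sum>i\<in>I. ((1 + \<delta>) * c i - \<delta> * b i) *\<^sub>R v i) \<in> ?S"
    proof (rule convex_sum)
      show "(\<Sum>i\<in>I. (1 + \<delta>) * c i - \<delta> * b i) = 1"
        by (simp add: sum_subtractf sum_distrib_left[symmetric] sum1 b)
      fix i assume i: "i \<in> I"
      have "b i \<le> sum b I" using b(1) i finite_index by (intro member_le_sum) auto
      then have "\<delta> * b i \<le> \<delta> * 1" using \<delta>(1) b(2) by (intro mult_left_mono) auto
      also have "\<dots> \<le> (1 + \<delta>) * c i" using \<delta>(1) \<delta>(2)[OF i] pos[OF i]
        by (simp add: distrib_right add_increasing2)
      finally show "0 \<le> (1 + \<delta>) * c i - \<delta> * b i" by simp
      show "v i \<in> ?S" using i by (simp add: hull_inc)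
    qed (use finite_index in auto)
    also have "(\<Sum>i\<in>I. ((1 + \<delta>) * c i - \<delta> * b i) *\<^sub>R v i) = (1 - (1 + \<delta>)) *\<^sub>R x + (1 + \<delta>) *\<^sub>R ?z"
      by (simp add: b(3) scaleR_diff_left sum_subtractf scaleR_sum_right sum_negf)
    finally show ?thesis using \<delta>(1) by (intro exI[of _ "1 + \<delta>"]) simp
  qed
  then show ?thesis
    using convex_rel_interior_iff[OF convex_convex_hull ne] by blast
qed

text \<open>The hull contains the point \<open>q\<close> at distance \<open>e\<close> from \<open>z\<close> in direction
  \<open>x\<close>. A linear functional on the hull is bounded by its values at the generating points, so some
  \<open>v i\<close> is at least as far out in direction \<open>x\<close> as \<open>q\<close>.\<close>

lemma rel_interior_coercive:
  fixes v :: "'i \<Rightarrow> 'a :: euclidean_space"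
  assumes "z \<in> rel_interior (convex hull (v ` I))"
  obtains e where "0 < e"
    "\<And>x. z + x \<in> affine hull (v ` I) \<Longrightarrow> \<exists>i\<in>I. e * norm x \<le> (v i - z) \<bullet> x"
proof -
  let ?A = "affine hull (v ` I)"
  obtain e where e: "0 < e" "cball z e \<inter> ?A \<subseteq> convex hull (v ` I)"
    and zS: "z \<in> convex hull (v ` I)"
    using assms unfolding mem_rel_interior_cball affine_hull_convex_hull by blast
  have index_nonempty: "I \<noteq> {}" using zS by auto
  have zA: "z \<in> ?A" using zS convex_hull_subset_affine_hull by blast
  have "\<exists>i\<in>I. e * norm x \<le> (v i - z) \<bullet> x" if x: "z + x \<in> ?A" for x
  proof (cases "x = 0")
    case True
    then show ?thesis using index_nonempty by auto
  next
    case False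
    define q where "q = z + (e / norm x) *\<^sub>R x"
    have "q = (1 - e / norm x) *\<^sub>R z + (e / norm x) *\<^sub>R (z + x)"
      by (simp add: q_def algebra_simps)
    then have "q \<in> ?A"
      using mem_affine[OF affine_affine_hull zA x, of "1 - e / norm x" "e / norm x"] by simp
    moreover have "q \<in> cball z e" using e(1) False by (simp add: q_def dist_norm)
    ultimately have q: "q \<in> convex hull (v ` I)" using e(2) by blast
    show ?thesis
    proof (rule ccontr)
      assume no: "\<not> (\<exists>i\<in>I. e * norm x \<le> (v i - z) \<bullet> x)"
      have "x \<bullet> q = x \<bullet> z + e * norm x"
        using False by (simp add: q_def inner_add_right power2_norm_eq_inner[symmetric] power2_eq_square)
      then have "v ` I \<subseteq> {y. x \<bullet> y < x \<bullet> q}"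
        using no by (auto simp: inner_diff_right inner_commute[of _ x] not_le algebra_simps)
      then have "convex hull (v ` I) \<subseteq> {y. x \<bullet> y < x \<bullet> q}"
        by (intro hull_minimal convex_halfspace_lt)
      then show False using q by blast
    qed
  qed
  then show ?thesis using e(1) that by blast
qed

section \<open>Exponential families with finite support\<close>

locale exponential_family =
  fixes I :: "'i set" and w :: "'i \<Rightarrow> real" and v :: "'i \<Rightarrow> 'a :: euclidean_space"
  assumes finite_index: "finite I"
    and index_nonempty: "I \<noteq> {}"
    and weight_pos: "i \<in> I \<Longrightarrow> 0 < w i"
begin

definition partition_function :: "'a \<Rightarrow> real" where
  "partition_function x = (\<Sum>i\<in>I. w i * exp (v i \<bullet> x))"

definition mean :: "'a \<Rightarrow> 'a" where
  "mean x = (\<Sum>i\<in>I. (w i * exp (v i \<bullet> x) / partition_function x) *\<^sub>R v i)"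

lemma partition_function_pos: "0 < partition_function x"
  unfolding partition_function_def
  by (intro sum_pos finite_index index_nonempty mult_pos_pos weight_pos exp_gt_zero)

lemma probabilities_sum_one: "(\<Sum>i\<in>I. w i * exp (v i \<bullet> x) / partition_function x) = 1"
  using partition_function_pos[of x] by (simp add: sum_divide_distrib[symmetric] partition_function_def)

text \<open>Translating all points by \<open>- z\<close> multiplies the numerators by a common positive factor and
  so does not change the distribution; the equation says that the translated mean is zero. In this
  form the denominator is gone, and the sum is the gradient at \<open>x\<close> of the sum of
  \<open>w i * exp ((v i - z) \<bullet> x)\<close>.\<close>

lemma mean_eq_iff_centred_sum_zero:
  "mean x = z \<longleftrightarrow> (\<Sum>i\<in>I. (w i * exp ((v i - z) \<bullet> x)) *\<^sub>R (v i - z)) = 0"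
proof -
  have "(\<Sum>i\<in>I. (w i * exp ((v i - z) \<bullet> x)) *\<^sub>R (v i - z))
      = (\<Sum>i\<in>I. (exp (- (z \<bullet> x)) * partition_function x) *\<^sub>R
          ((w i * exp (v i \<bullet> x) / partition_function x) *\<^sub>R (v i - z)))"
    using partition_function_pos[of x]
    by (intro sum.cong) (simp_all add: inner_diff_left exp_diff exp_minus field_simps)
  also have "\<dots> = (exp (- (z \<bullet> x)) * partition_function x) *\<^sub>R
      (mean x - (\<Sum>i\<in>I. w i * exp (v i \<bullet> x) / partition_function x) *\<^sub>R z)"
    by (simp add: mean_def scaleR_sum_right[symmetric] scaleR_diff_right
        sum_subtractf scaleR_sum_left del: scaleR_scaleR)
  also have "\<dots> = (exp (- (z \<bullet> x)) * partition_function x) *\<^sub>R (mean x - z)"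
    by (simp add: probabilities_sum_one)
  finally show ?thesis
    using partition_function_pos[of x] by simp
qed

lemma mean_in_rel_interior: "mean x \<in> rel_interior (convex hull (v ` I))"
  unfolding mean_def
  by (rule positive_combination_in_rel_interior[OF finite_index])
    (use partition_function_pos[of x] weight_pos in \<open>auto simp: probabilities_sum_one\<close>)

text \<open>If both means are \<open>z\<close>, subtracting the two centred equations and pairing with \<open>x - y\<close>
  gives a vanishing sum of terms \<open>(exp a - exp b) * (a - b)\<close> with positive weights, where
  \<open>a = (v i - z) \<bullet> x\<close> and \<open>b = (v i - z) \<bullet> y\<close>. Each term is nonnegative, so
  \<open>a = b\<close> for every \<open>i\<close>. Conversely, if \<open>v i \<bullet> (x - y)\<close> is independent of
  \<open>i\<close>, passing from \<open>y\<close> to \<open>x\<close> rescales all the exponentials by one constant, which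
  cancels in the mean.\<close>

lemma mean_eq_iff:
  "mean x = mean y \<longleftrightarrow> (\<forall>i\<in>I. \<forall>j\<in>I. (v i - v j) \<bullet> (x - y) = 0)"
proof
  assume eq: "mean x = mean y"
  define z where "z = mean x"
  let ?g = "\<lambda>x. \<Sum>i\<in>I. (w i * exp ((v i - z) \<bullet> x)) *\<^sub>R (v i - z)"
  have "?g x = 0" "?g y = 0"
    using mean_eq_iff_centred_sum_zero[of x z] mean_eq_iff_centred_sum_zero[of y z] eq
    by (auto simp: z_def)
  then have "0 = (?g x - ?g y) \<bullet> (x - y)" by simp
  also have "\<dots> = (\<Sum>i\<in>I. w i *
      ((exp ((v i - z) \<bullet> x) - exp ((v i - z) \<bullet> y)) * ((v i - z) \<bullet> x - (v i - z) \<bullet> y)))"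
    by (simp add: sum_subtractf[symmetric] scaleR_diff_left[symmetric] inner_sum_left
        inner_diff_right[of "_ - _" x y] right_diff_distrib[of "w _", symmetric] mult.assoc)
  finally have "\<forall>i\<in>I. w i *
      ((exp ((v i - z) \<bullet> x) - exp ((v i - z) \<bullet> y)) * ((v i - z) \<bullet> x - (v i - z) \<bullet> y)) = 0"
    using weight_pos
    by (subst (asm) eq_commute, subst (asm) sum_nonneg_eq_0_iff[OF finite_index])
      (auto intro!: mult_nonneg_nonneg less_imp_le[OF weight_pos] simp: zero_le_mult_iff)
  then have const: "(v i - z) \<bullet> x = (v i - z) \<bullet> y" if "i \<in> I" for i
    using that weight_pos[OF that] by auto
  show "\<forall>i\<in>I. \<forall>j\<in>I. (v i - v j) \<bullet> (x - y) = 0"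
  proof (intro ballI)
    fix i j assume "i \<in> I" "j \<in> I"
    then show "(v i - v j) \<bullet> (x - y) = 0"
      using const[of i] const[of j] by (simp add: inner_diff_left inner_diff_right)
  qed
next
  assume const: "\<forall>i\<in>I. \<forall>j\<in>I. (v i - v j) \<bullet> (x - y) = 0"
  obtain k where k: "k \<in> I" using index_nonempty by blast
  define c where "c = exp (v k \<bullet> (x - y))"
  have shift: "exp (v i \<bullet> x) = c * exp (v i \<bullet> y)" if "i \<in> I" for i
  proof -
    have "v i \<bullet> x = v k \<bullet> (x - y) + v i \<bullet> y"
      using bspec[OF bspec[OF const that] k] by (simp add: inner_diff_left inner_diff_right)
    then show ?thesis by (simp add: c_def exp_add)
  qed
  have c0: "c \<noteq> 0" by (simp add: c_def)
  have part: "partition_function x = c * partition_function y"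
    by (simp add: partition_function_def shift sum_distrib_left mult.left_commute)
  show "mean x = mean y"
    unfolding mean_def part by (intro sum.cong) (simp_all add: shift c0 mult.left_commute[of _ c])
qed

text \<open>The parameter is found by minimizing the function \<open>G\<close> of the proof over the direction space
  \<open>L\<close> of the affine hull. There \<open>G\<close> is coercive, whereas it is constant in directions
  orthogonal to \<open>L\<close>. As the gradient of \<open>G\<close> lies in \<open>L\<close>, a minimum on \<open>L\<close> is
  already a critical point.\<close>

lemma rel_interior_is_mean:
  assumes z: "z \<in> rel_interior (convex hull (v ` I))"
  shows "\<exists>x. mean x = z"
proof -
  define L where "L = (\<lambda>p. p - z) ` (affine hull (v ` I))"
  have "z \<in> affine hull (v ` I)"
    using z rel_interior_subset convex_hull_subset_affine_hull by blast
  then have L: "subspace L"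
    unfolding L_def by (intro affine_diffs_subspace_subtract affine_affine_hull)
  have vL: "v i - z \<in> L" if "i \<in> I" for i
    using that by (auto simp: L_def hull_inc)
  obtain e where e: "0 < e" "\<And>x. x \<in> L \<Longrightarrow> \<exists>i\<in>I. e * norm x \<le> (v i - z) \<bullet> x"
    using rel_interior_coercive[OF z] unfolding L_def
    by (metis (no_types, lifting) imageE
        add_diff_cancel_left' diff_add_cancel add.commute)
  define G where "G = (\<lambda>x. \<Sum>i\<in>I. w i * exp ((v i - z) \<bullet> x))"
  define m where "m = Min (w ` I)"
  have m: "0 < m" "\<And>i. i \<in> I \<Longrightarrow> m \<le> w i"
    using weight_pos finite_index index_nonempty by (auto simp: m_def)
  have lower: "m * (e * norm x) < G x" if "x \<in> L" for x
  proof -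
    obtain k where k: "k \<in> I" "e * norm x \<le> (v k - z) \<bullet> x" using e(2)[OF \<open>x \<in> L\<close>] by blast
    have "m * (e * norm x) < m * exp ((v k - z) \<bullet> x)"
      using k(2) m(1) exp_ge_add_one_self[of "(v k - z) \<bullet> x"] by (intro mult_strict_left_mono) linarith+
    also have "\<dots> \<le> w k * exp ((v k - z) \<bullet> x)" using m(2)[OF k(1)] by simp
    also have "\<dots> \<le> G x" unfolding G_def
      using k(1) finite_index weight_pos
      by (intro member_le_sum[where f = "\<lambda>i. w i * exp ((v i - z) \<bullet> x)"]) (auto intro: less_imp_le)
    finally show ?thesis .
  qed
  \<comment> \<open>Outside the ball of radius \<open>R\<close> the lower bound exceeds \<open>G 0\<close>, so a minimum over the
    compact set \<open>L \<inter> cball 0 R\<close> is a minimum over \<open>L\<close>.\<close>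
  define R where "R = G 0 / (m * e)"
  have G0: "0 \<le> G 0" unfolding G_def using weight_pos by (intro sum_nonneg) (simp add: less_imp_le)
  have "0 \<le> R" using G0 m(1) e(1) by (simp add: R_def)
  have "compact (L \<inter> cball 0 R)"
    by (intro closed_Int_compact compact_cball closed_subspace L)
  moreover have zero: "0 \<in> L \<inter> cball 0 R" using \<open>0 \<le> R\<close> subspace_0[OF L] by simp
  moreover have "continuous_on (L \<inter> cball 0 R) G"
    unfolding G_def by (intro continuous_intros)
  ultimately obtain x where x: "x \<in> L \<inter> cball 0 R" "\<And>y. y \<in> L \<inter> cball 0 R \<Longrightarrow> G x \<le> G y"
    using continuous_attains_inf[of "L \<inter> cball 0 R" G] by blast
  have minimal: "G x \<le> G y" if "y \<in> L" for y
  proof (cases "norm y \<le> R")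
    case False
    have "G x \<le> G 0" using x(2) zero by blast
    also have "G 0 \<le> m * (e * norm y)" using False m(1) e(1) by (simp add: R_def field_simps)
    finally show ?thesis using lower[OF that] by simp
  qed (use x(2) that in simp)
  define g where "g = (\<Sum>i\<in>I. (w i * exp ((v i - z) \<bullet> x)) *\<^sub>R (v i - z))"
  have "g \<in> L" unfolding g_def by (intro subspace_sum subspace_scale L vL)
  \<comment> \<open>The derivative of \<open>G\<close> at \<open>x\<close> in the direction of the gradient \<open>g\<close> itself is
    \<open>g \<bullet> g\<close>.\<close>
  have "((\<lambda>t. G (x + t *\<^sub>R g)) has_real_derivative
      (\<Sum>i\<in>I. w i * (exp ((v i - z) \<bullet> (x + 0 *\<^sub>R g)) * ((v i - z) \<bullet> g)))) (at 0)"
    unfolding G_def inner_add_right inner_scaleR_right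
    by (auto intro!: derivative_eq_intros sum.cong)
  moreover have "\<forall>t. \<bar>0 - t\<bar> < 1 \<longrightarrow> G (x + 0 *\<^sub>R g) \<le> G (x + t *\<^sub>R g)"
    using minimal x(1) \<open>g \<in> L\<close> by (auto intro!: minimal subspace_add subspace_scale L)
  ultimately have "(\<Sum>i\<in>I. w i * (exp ((v i - z) \<bullet> (x + 0 *\<^sub>R g)) * ((v i - z) \<bullet> g))) = 0"
    by (intro DERIV_local_min[where d = 1]) auto
  then have "g \<bullet> g = 0"
    by (subst (1) g_def) (simp add: inner_sum_left mult.assoc)
  then show ?thesis
    using mean_eq_iff_centred_sum_zero[of x z] by (auto simp: g_def)
qed

theorem range_mean: "range mean = rel_interior (convex hull (v ` I))"
  using mean_in_rel_interior rel_interior_is_mean by (auto, metis rangeI)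

end

section \<open>Fibres of a configuration matrix\<close>

lemma inner_transpose_real_mat:
  "real_vec u \<bullet> (transpose (real_mat A) *v y) = real_vec (A *v u) \<bullet> y"
proof -
  have "real_mat A *v real_vec u = real_vec (A *v u)"
    by (simp add: vec_eq_iff matrix_vector_mult_def real_mat_def real_vec_def)
  then show ?thesis
    by (simp add: dot_lmul_matrix inner_commute[of "real_vec u"] inner_commute[of y])
qed

text \<open>Pairing \<open>u\<close> with an element of the row space of \<open>A\<close> depends only on \<open>A u\<close>, which
  is \<open>\<beta>\<close> throughout the fibre.\<close>

lemma image_transpose_orthogonal_fiber:
  assumes "u \<in> fiber A \<beta>" "u' \<in> fiber A \<beta>" "x \<in> image_transpose A"
  shows "(real_vec u - real_vec u') \<bullet> x = 0"
  using assms unfolding fiber_def image_transpose_def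
  by (auto simp: inner_diff_left inner_transpose_real_mat simp del: transpose_matrix_vector)

text \<open>If the all-ones vector is the image of \<open>y\<close> under the transpose, the coordinate sum of every
  point of the fibre equals \<open>\<beta> \<bullet> y\<close>. This bounds each coordinate.\<close>

lemma finite_fiber:
  fixes A :: "nat ^ 'n ^ 'd"
  assumes "configuration_matrix A"
  shows "finite (fiber A \<beta>)"
proof -
  obtain y where y: "(\<chi> i. 1) = transpose (real_mat A) *v y"
    using assms unfolding configuration_matrix_def image_transpose_def by auto
  define N where "N = nat \<lfloor>real_vec \<beta> \<bullet> y\<rfloor>"
  have "u $ i \<le> N" if "u \<in> fiber A \<beta>" for u i
  proof -
    have "real (u $ i) \<le> (\<Sum>j\<in>UNIV. real (u $ j))" by (intro member_le_sum) auto
    also have "\<dots> = real_vec u \<bullet> (\<chi> i. 1)" by (simp add: inner_vec_def real_vec_def)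
    also have "\<dots> = real_vec \<beta> \<bullet> y"
      using that by (simp only: y inner_transpose_real_mat) (simp add: fiber_def)
    finally show ?thesis unfolding N_def by (simp add: le_nat_floor)
  qed
  then have "vec_nth ` fiber A \<beta> \<subseteq> PiE UNIV (\<lambda>_. {..N})" by auto
  moreover have "finite (PiE (UNIV :: 'n set) (\<lambda>_. {..N}))" by (intro finite_PiE) auto
  ultimately have "finite (vec_nth ` fiber A \<beta>)" by (rule finite_subset)
  then show ?thesis
    by (rule finite_imageD) (simp add: inj_on_def vec_nth_inject)
qed

lemma fiber_nonempty:
  assumes "\<beta> \<in> column_monoid A"
  shows "fiber A \<beta> \<noteq> {}"
proof -
  obtain c where "\<beta> = (\<Sum>i\<in>UNIV. c i *s column i A)"
    using assms unfolding column_monoid_def by auto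
  then have "(\<chi> i. c i) \<in> fiber A \<beta>"
    by (simp add: fiber_def matrix_mult_sum)
  then show ?thesis by blast
qed

lemma monomial_at_exp_vec: "monomial_at (exp_vec \<xi>) u = exp (real_vec u \<bullet> \<xi>)"
  by (simp add: monomial_at_def exp_vec_def real_vec_def inner_vec_def exp_sum exp_of_nat_mult)

lemma multi_fact_pos: "0 < multi_fact u"
  unfolding multi_fact_def by (intro prod_pos) simp

lemma exponential_family_fiber:
  assumes "configuration_matrix A" "\<beta> \<in> column_monoid A"
  shows "exponential_family (fiber A \<beta>) (\<lambda>u. 1 / multi_fact u)"
  using assms by unfold_locales (simp_all add: finite_fiber fiber_nonempty multi_fact_pos)

lemma moment_map_eq_mean:
  assumes "exponential_family (fiber A \<beta>) (\<lambda>u. 1 / multi_fact u)"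
  shows "moment_map A \<beta> = exponential_family.mean (fiber A \<beta>) (\<lambda>u. 1 / multi_fact u) real_vec"
proof -
  interpret exponential_family "fiber A \<beta>" "\<lambda>u. 1 / multi_fact u" real_vec by fact
  show ?thesis
    by (rule ext) (simp add: vec_eq_iff moment_map_def mean_def hypergeometric_prob_def
        partition_function_def hypergeometric_poly_def monomial_at_exp_vec real_vec_def mult.commute)
qed

text \<open>The orthogonal complement \<open>P\<close> of the direction space of the Newton polytope contains the
  row space of \<open>A\<close>. The hypothesis on the dimension of the polytope gives
  \<open>dim P = n - (n - d) = d\<close>, which is the rank of \<open>A\<close>, so the two subspaces coincide.\<close>

lemma orthogonal_fiber_in_image_transpose:
  fixes A :: "nat ^ 'n ^ 'd"
  assumes rank: "rank (real_mat A) = CARD('d)"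
    and dim: "aff_dim (newton_polytope A \<beta>) = int CARD('n) - int CARD('d)"
    and u0: "u\<^sub>0 \<in> fiber A \<beta>"
    and orth: "\<And>u. u \<in> fiber A \<beta> \<Longrightarrow> (real_vec u - real_vec u\<^sub>0) \<bullet> x = 0"
  shows "x \<in> image_transpose A"
proof -
  define D where "D = (\<lambda>p. p - real_vec u\<^sub>0) ` (real_vec ` fiber A \<beta>)"
  define P where "P = {y \<in> UNIV. \<forall>d\<in>span D. orthogonal d y}"
  have P: "y \<in> P" if "\<And>u. u \<in> fiber A \<beta> \<Longrightarrow> (real_vec u - real_vec u\<^sub>0) \<bullet> y = 0" for y
  proof -
    have "D \<subseteq> {d. orthogonal y d}" using that by (auto simp: D_def orthogonal_def inner_commute)
    then have "span D \<subseteq> {d. orthogonal y d}"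
      by (intro span_minimal subspace_orthogonal_to_vector)
    then show ?thesis by (auto simp: P_def orthogonal_commute)
  qed
  have "aff_dim (real_vec ` fiber A \<beta>) = int (dim D)"
    unfolding D_def using u0 by (intro aff_dim_eq_dim_subtract hull_inc) auto
  then have "int (dim D) = int CARD('n) - int CARD('d)"
    using dim by (simp add: newton_polytope_def aff_dim_convex_hull)
  moreover have "dim P + dim (span D) = dim (UNIV :: (real ^ 'n) set)"
    unfolding P_def by (intro dim_subspace_orthogonal_to_vectors) auto
  ultimately have "dim P = CARD('d)" by simp
  also have "\<dots> = dim (image_transpose A)"
    unfolding image_transpose_def rank_dim_range[symmetric] rank_transpose rank ..
  finally have "dim P = dim (image_transpose A)" .
  moreover have "subspace (image_transpose A)"
    unfolding image_transpose_def
    by (intro linear_subspace_image matrix_vector_mul_linear subspace_UNIV)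
  moreover have "subspace P"
    unfolding P_def subspace_def by (auto simp: orthogonal_clauses)
  moreover have "image_transpose A \<subseteq> P"
    by (auto intro!: P image_transpose_orthogonal_fiber[OF _ u0])
  ultimately have "image_transpose A = P" by (intro subspace_dim_equal) auto
  then show ?thesis using P[OF orth] by simp
qed

section \<open>The moment map modulo the row space\<close>

lemma induced_map_quotient:
  assumes r: "equiv UNIV r" and iff: "\<And>x y. f x = f y \<longleftrightarrow> (x, y) \<in> r"
  shows "inj_on (induced_map f) (UNIV // r)"
    and "induced_map f ` (UNIV // r) = range f"
proof -
  have val: "induced_map f (r `` {x}) = f x" for x
  proof -
    have "f ` (r `` {x}) = {f x}"
      using iff equiv_class_self[OF r, of x] by (auto simp: iff[symmetric])
    then show ?thesis by (simp add: induced_map_def)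
  qed
  show "inj_on (induced_map f) (UNIV // r)"
    by (auto intro!: inj_onI elim!: quotientE simp: val iff equiv_class_eq_iff[OF r])
  show "induced_map f ` (UNIV // r) = range f"
    by (auto simp: quotient_def val image_iff)
qed

theorem theorem1:
  fixes A :: "nat ^ 'n ^ 'd" and \<beta> :: "nat ^ 'd"
  assumes "rank (real_mat A) = CARD('d)"
    and "configuration_matrix A"
    and "\<beta> \<in> column_monoid A"
    and "\<beta> \<noteq> 0"
    and "aff_dim (newton_polytope A \<beta>) = int CARD('n) - int CARD('d)"
  shows "range (moment_map A \<beta>) = rel_interior (newton_polytope A \<beta>)
    \<and> (moment_map A \<beta>) respects (coset_rel A)
    \<and> induced_map (moment_map A \<beta>)
        \<in> (UNIV // coset_rel A) \<rightarrow> rel_interior (newton_polytope A \<beta>)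
    \<and> inj_on (induced_map (moment_map A \<beta>)) (UNIV // coset_rel A)"
proof -
  note family = exponential_family_fiber[OF assms(2,3)]
  interpret exponential_family "fiber A \<beta>" "\<lambda>u. 1 / multi_fact u" real_vec by (fact family)
  obtain u\<^sub>0 where u0: "u\<^sub>0 \<in> fiber A \<beta>" using index_nonempty by blast
  have eq_iff: "moment_map A \<beta> \<xi> = moment_map A \<beta> \<eta> \<longleftrightarrow> (\<xi>, \<eta>) \<in> coset_rel A" for \<xi> \<eta>
    unfolding moment_map_eq_mean[OF family] mean_eq_iff coset_rel_def
    using image_transpose_orthogonal_fiber[of _ A \<beta>]
      orthogonal_fiber_in_image_transpose[OF assms(1,5) u0] u0
    by blast
  have equiv: "equiv UNIV (coset_rel A)"
    by (rule equivI) (auto simp: refl_on_def sym_def trans_def eq_iff[symmetric])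
  have range: "range (moment_map A \<beta>) = rel_interior (newton_polytope A \<beta>)"
    unfolding moment_map_eq_mean[OF family] newton_polytope_def by (rule range_mean)
  moreover have "moment_map A \<beta> respects coset_rel A"
    by (rule congruentI) (simp add: eq_iff)
  moreover have "induced_map (moment_map A \<beta>) \<in> (UNIV // coset_rel A) \<rightarrow> rel_interior (newton_polytope A \<beta>)"
    using induced_map_quotient(2)[OF equiv eq_iff] range by blast
  ultimately show ?thesis
    using induced_map_quotient(1)[OF equiv eq_iff] by blast
qed

end
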